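(* Let $(B,\|\cdot\|_B)$ be a Banach space and let $V\subset B$ be a dense linear subspace equipped with its own norm $\|\cdot\|_V$ making it a Banach space, with $\|v\|_B\le\|v\|_V$ for all $v\in V$. Assume that $(B,\|\cdot\|_B)$ and $(V,\|\cdot\|_V)$ both have separable duals. Assume further: (1) $T:(X,\mathscr F,m)\to(X,\mathscr F,m)$ is a measure-preserving transformation of a probability space (not necessarily invertible or ergodic); (2) $A:X\to L(B)$ is strongly measurable and $A(x)\in L(B)$ is compact for all $x\in X$; (3) for all $x\in X$ the restriction $A(x)|_V$ has range contained in $V$ and is a compact linear operator $V\to V$, and $x\mapsto A(x)|_V$ is strongly measurable as a map $X\to L(V)$; (4) $\int\log^+\|A(x)\|_B\,dm(x)<\infty$ and $\int\log^+\|A(x)|_V\|_V\,dm(x)<\infty$. For $W\in\{B,V\}$ let $r^W(x)$, $\lambda_i^W(x)$, $F_i^W(x)$ denote the number of Lyapunov exponents, the Lyapunov exponents and the associated filtration of the cocycle generated by $A$, regarded as a cocycle on $W$ (see context). Then $r^V(x)=r^B(x)$ for $m$-a.e. $x\in X$. Writing $r(x)$ for this common value, for all $i\ge1$ and for $m$-a.e. $x\in\{r\ge i\}$ one has $$\lambda_i^V(x)=\lambda_i^B(x)\qquad\text{and}\qquad F_i^V(x)=F_i^B(x)\cap V.$$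
   Context: $L(W)$ is the space of bounded linear operators on $W$, with operator norm $\|\cdot\|_W$. A map $A:X\to L(W)$ with $W$ separable is strongly measurable if $x\mapsto A(x)v$ is Borel measurable for each $v\in W$. The cocycle generated by $A$ over $T$ is $A^n_x=A(T^{n-1}x)\cdots A(Tx)A(x)$, $n\ge1$. Convention: $\log0=-\infty$. Lyapunov data. Let $W$ be $B$ or $V$. Under the hypotheses, the Multiplicative Ergodic Theorem for compact cocycles (which may be taken as known) applies on $W$: for $m$-a.e. $x$ and all $v\in W$ the limit $\lambda^W(x,v)=\lim_{n\to\infty}\frac1n\log\|A^n_xv\|_W\in[-\infty,\infty)$ exists. For such $x$ the set of finite values of $\lambda^W(x,\cdot)$ is at most countable, bounded above, and has only finitely many elements above any given real number. $r^W(x)\in\{0,1,2,\dots\}\cup\{\infty\}$ denotes the number of these values, and $\lambda_1^W(x)>\lambda_2^W(x)>\cdots$ lists them in decreasing order. For $1\le i\le r^W(x)$, $F_i^W(x)=\{v\in W:\lambda^W(x,v)\le\lambda^W_i(x)\}$, a closed finite-codimensional subspace of $W$ depending measurably on $x$, with $F_1^W(x)=W$. If $r^W(x)<\infty$, $F^W_{r^W(x)+1}(x)=\{v\in W:\lambda^W(x,v)=-\infty\}$ (also closed and of finite codimension). Thus $\lambda^W(x,v)=\lambda_i^W(x)$ exactly for $v\in F_i^W(x)\setminus F_{i+1}^W(x)$. *)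

theory Defs
  imports "HOL-Probability.Probability"
begin

definition compact_operator :: "('a::real_normed_vector \<Rightarrow>\<^sub>L 'b::real_normed_vector) \<Rightarrow> bool" where
  "compact_operator L \<longleftrightarrow> compact (closure (blinfun_apply L ` cball 0 1))"

definition separable_dual :: "'a::real_normed_vector itself \<Rightarrow> bool" where
  "separable_dual _ \<longleftrightarrow> separable_space (euclidean :: ('a \<Rightarrow>\<^sub>L real) topology)"

definition strongly_measurable ::
  "'x measure \<Rightarrow> ('x \<Rightarrow> 'w::real_normed_vector \<Rightarrow>\<^sub>L 'w) \<Rightarrow> bool" where
  "strongly_measurable M A \<longleftrightarrow> (\<forall>v. (\<lambda>x. A x v) \<in> borel_measurable M)"

(* Since HOL sets ln 0 = 0, log_plus 0 = 0 as it should be. *)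
definition log_plus :: "real \<Rightarrow> real" where
  "log_plus t = max 0 (ln t)"

(* Only applied to norms, that is, to t >= 0. *)
definition elog :: "real \<Rightarrow> ereal" where
  "elog t = (if t = 0 then -\<infinity> else ereal (ln t))"

primrec cocycle ::
  "('x \<Rightarrow> 'x) \<Rightarrow> ('x \<Rightarrow> 'w::real_normed_vector \<Rightarrow>\<^sub>L 'w) \<Rightarrow> nat \<Rightarrow> 'x \<Rightarrow> 'w \<Rightarrow>\<^sub>L 'w" where
  "cocycle T A 0 x = id_blinfun"
| "cocycle T A (Suc n) x = A ((T ^^ n) x) o\<^sub>L cocycle T A n x"

definition growth_seq ::
  "('x \<Rightarrow> 'x) \<Rightarrow> ('x \<Rightarrow> 'w::real_normed_vector \<Rightarrow>\<^sub>L 'w) \<Rightarrow> 'x \<Rightarrow> 'w \<Rightarrow> nat \<Rightarrow> ereal" where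
  "growth_seq T A x v n = ereal (1 / real n) * elog (norm (cocycle T A n x v))"

(* A junk value where the limit does not exist. *)
definition lyap ::
  "('x \<Rightarrow> 'x) \<Rightarrow> ('x \<Rightarrow> 'w::real_normed_vector \<Rightarrow>\<^sub>L 'w) \<Rightarrow> 'x \<Rightarrow> 'w \<Rightarrow> ereal" where
  "lyap T A x v = lim (growth_seq T A x v)"

definition lyap_values ::
  "('x \<Rightarrow> 'x) \<Rightarrow> ('x \<Rightarrow> 'w::real_normed_vector \<Rightarrow>\<^sub>L 'w) \<Rightarrow> 'x \<Rightarrow> real set" where
  "lyap_values T A x = {c. \<exists>v. lyap T A x v = ereal c}"

definition num_lyap ::
  "('x \<Rightarrow> 'x) \<Rightarrow> ('x \<Rightarrow> 'w::real_normed_vector \<Rightarrow>\<^sub>L 'w) \<Rightarrow> 'x \<Rightarrow> enat" where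
  "num_lyap T A x =
     (if finite (lyap_values T A x) then enat (card (lyap_values T A x)) else \<infinity>)"

(* The i-th largest value, counted from i = 1; meaningful for 1 <= i <= num_lyap T A x
   when only finitely many values lie above any given real. *)
definition lyap_exp ::
  "('x \<Rightarrow> 'x) \<Rightarrow> ('x \<Rightarrow> 'w::real_normed_vector \<Rightarrow>\<^sub>L 'w) \<Rightarrow> nat \<Rightarrow> 'x \<Rightarrow> real" where
  "lyap_exp T A i x =
     (THE c. c \<in> lyap_values T A x \<and> card {d \<in> lyap_values T A x. c \<le> d} = i)"

definition lyap_filt ::
  "('x \<Rightarrow> 'x) \<Rightarrow> ('x \<Rightarrow> 'w::real_normed_vector \<Rightarrow>\<^sub>L 'w) \<Rightarrow> nat \<Rightarrow> 'x \<Rightarrow> 'w set" where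
  "lyap_filt T A i x =
     (if enat i \<le> num_lyap T A x then {v. lyap T A x v \<le> ereal (lyap_exp T A i x)}
      else {v. lyap T A x v = -\<infinity>})"

definition finite_codim :: "'a::real_vector set \<Rightarrow> bool" where
  "finite_codim S \<longleftrightarrow> subspace S \<and> (\<exists>K. finite K \<and> span (S \<union> K) = UNIV)"

(* The conclusion of the Multiplicative Ergodic Theorem for compact cocycles. That the set of
   values is countable and bounded above follows from the second conjunct. In the third conjunct
   the index i = r + 1, with r = num_lyap T A x finite, stands for the subspace of exponent
   -infinity. Measurability of the filtration in x is left out: it is not needed,
   and omitting it makes the predicate weaker. *)
definition met_conclusion ::
  "'x measure \<Rightarrow> ('x \<Rightarrow> 'x) \<Rightarrow> ('x \<Rightarrow> 'w::real_normed_vector \<Rightarrow>\<^sub>L 'w) \<Rightarrow> bool" where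
  "met_conclusion M T A \<longleftrightarrow> (AE x in M.
     (\<forall>v. convergent (growth_seq T A x v) \<and> lyap T A x v < \<infinity>) \<and>
     (\<forall>c. finite {d \<in> lyap_values T A x. c < d}) \<and>
     (\<forall>i\<ge>1. enat i \<le> eSuc (num_lyap T A x) \<longrightarrow>
        closed (lyap_filt T A i x) \<and> finite_codim (lyap_filt T A i x)))"

end

theory Submission
  imports Defs "HOL-Real_Asymp.Real_Asymp"
begin

text \<open>
  For \<open>v \<in> V\<close> the exponent in \<open>V\<close> clearly dominates the one in \<open>B\<close>. For the converse, compactness
  of \<open>A x\<close> on \<open>V\<close> gives, for every \<open>\<epsilon> > 0\<close>, an interpolation inequality
  \<open>\<parallel>A(x)v\<parallel>\<^sub>V \<le> \<epsilon> \<parallel>v\<parallel>\<^sub>V + k \<parallel>v\<parallel>\<^sub>B\<close> with \<open>k\<close> depending on \<open>x\<close>. A large constant \<open>k\<close> works for all \<open>x\<close>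
  off a small set \<open>Z\<^sub>k\<close>, where only the bound by \<open>\<parallel>A(x)\<parallel>\<^sub>V\<close> is available. By the maximal ergodic
  inequality, for almost every \<open>x\<close> and some \<open>k\<close> the logarithmic cost of the visits to \<open>Z\<^sub>k\<close> up to
  time \<open>n\<close> is at most \<open>\<alpha> n\<close> for all \<open>n\<close>, so iterating the inequality shows
  \<open>\<lambda>\<^sup>V(x,v) \<le> \<lambda>\<^sup>B(x,v) + \<alpha>\<close>. Hence the exponents agree on \<open>V\<close>; and they take the same values,
  because \<open>V\<close> meets each \<open>F\<^sub>i\<^sup>B(x)\<close> in a dense subset, by closedness and finite codimension.
\<close>

subsection \<open>Separation in normed spaces\<close>

text \<open>This is the one-dimensional step of the Hahn-Banach theorem. A functional is encoded by
  its graph, so that extension becomes inclusion; domination by \<open>p\<close>, with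
  \<open>p 0 = 0\<close>, forces a graph that is a subspace to be single-valued.\<close>

lemma sublinear_graph_extend:
  fixes p :: "'a::real_vector \<Rightarrow> real" and G :: "('a \<times> real) set"
  assumes add: "\<And>x y. p (x + y) \<le> p x + p y"
    and scale: "\<And>t x. 0 \<le> t \<Longrightarrow> p (t *\<^sub>R x) = t * p x"
    and G: "subspace G" and dom: "\<And>x a. (x, a) \<in> G \<Longrightarrow> a \<le> p x"
  obtains G' where "G \<subseteq> G'" "subspace G'" "\<And>x a. (x, a) \<in> G' \<Longrightarrow> a \<le> p x" "y \<in> fst ` G'"
proof -
  \<comment> \<open>The value assigned to \<open>y\<close>. Vectors \<open>x - y\<close> bound it
    from below and vectors \<open>x' + y\<close> from above; by \<open>key\<close> every lower bound
    lies under every upper one, so the supremum of the lower bounds satisfies both.\<close>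
  define c where "c = (SUP (x, a)\<in>G. a - p (x - y))"
  have zero: "(0, 0) \<in> G"
    using subspace_0[OF G] by (simp add: zero_prod_def)
  have key: "a - p (x - y) \<le> p (x' + y) - a'" if "(x, a) \<in> G" "(x', a') \<in> G" for x a x' a'
  proof -
    have "(x + x', a + a') \<in> G"
      using subspace_add[OF G that] by simp
    then have "a + a' \<le> p (x + x')" by (rule dom)
    also have "\<dots> \<le> p (x - y) + p (x' + y)"
      using add[of "x - y" "x' + y"] by simp
    finally show ?thesis by simp
  qed
  have bdd: "bdd_above ((\<lambda>(x, a). a - p (x - y)) ` G)"
    using key[OF _ zero] by (intro bdd_aboveI2[where M = "p y"]) auto
  have lower: "a - p (x - y) \<le> c" if "(x, a) \<in> G" for x a
    unfolding c_def using cSUP_upper[OF that bdd] by simp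
  have upper: "c \<le> p (x' + y) - a'" if "(x', a') \<in> G" for x' a'
    unfolding c_def using zero key[OF _ that] by (intro cSUP_least) auto
  define G' where "G' = {u + v | u v. u \<in> G \<and> v \<in> span {(y, c)}}"
  show thesis
  proof
    show "subspace G'"
      unfolding G'_def by (intro subspace_sums G subspace_span)
    show "G \<subseteq> G'"
    proof
      fix u assume "u \<in> G"
      then have "u + 0 \<in> G'"
        unfolding G'_def using span_zero by blast
      then show "u \<in> G'" by simp
    qed
    show "y \<in> fst ` G'"
      unfolding G'_def using zero span_base[of "(y, c)" "{(y, c)}"] by (force simp: zero_prod_def)
    fix z b
    assume "(z, b) \<in> G'"
    then obtain x a t where xa: "(x, a) \<in> G" and z: "z = x + t *\<^sub>R y" and b: "b = a + t * c"
      unfolding G'_def by (auto simp: span_singleton)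
    \<comment> \<open>For nonzero \<open>t\<close>, positive homogeneity allows division by the
      modulus of \<open>t\<close>, which reduces the claim to \<open>upper\<close> or
      \<open>lower\<close>.\<close>
    consider "t = 0" | "t > 0" | "t < 0" by linarith
    then show "b \<le> p z"
    proof cases
      case 1
      then show ?thesis using dom[OF xa] z b by simp
    next
      case 2
      have "((1/t) *\<^sub>R x, (1/t) * a) \<in> G"
        using subspace_scale[OF G xa, of "1/t"] by simp
      from upper[OF this] have "t * c \<le> t * (p ((1/t) *\<^sub>R x + y) - (1/t) * a)"
        using 2 by (intro mult_left_mono) auto
      also have "\<dots> = p (t *\<^sub>R ((1/t) *\<^sub>R x + y)) - a"
        using 2 scale[of t "(1/t) *\<^sub>R x + y"] by (simp add: right_diff_distrib)
      also have "t *\<^sub>R ((1/t) *\<^sub>R x + y) = z"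
        using 2 z by (simp add: scaleR_add_right)
      finally show ?thesis using b by simp
    next
      case 3
      define s where "s = - t"
      have s: "s > 0" "t = - s" using 3 by (auto simp: s_def)
      have "((1/s) *\<^sub>R x, (1/s) * a) \<in> G"
        using subspace_scale[OF G xa, of "1/s"] by simp
      from lower[OF this] have "s * ((1/s) * a - p ((1/s) *\<^sub>R x - y)) \<le> s * c"
        using s by (intro mult_left_mono) auto
      also have "s * ((1/s) * a - p ((1/s) *\<^sub>R x - y)) = a - p (s *\<^sub>R ((1/s) *\<^sub>R x - y))"
        using s scale[of s "(1/s) *\<^sub>R x - y"] by (simp add: right_diff_distrib)
      also have "s *\<^sub>R ((1/s) *\<^sub>R x - y) = z"
        using s z by (simp add: scaleR_diff_right)
      finally show ?thesis using b s by simp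
    qed
  qed
qed

text \<open>Zorn's lemma yields a maximal dominated graph through \<open>(y, p y)\<close>, and the
  one-dimensional extension shows that its domain is everything. The line through
  \<open>(y, p y)\<close> is a starting point: it is dominated in the negative direction because
  \<open>0 \<le> p y + p (- y)\<close>.\<close>

lemma sublinear_dominated_functional:
  fixes p :: "'a::real_vector \<Rightarrow> real"
  assumes add: "\<And>x y. p (x + y) \<le> p x + p y"
    and scale: "\<And>t x. 0 \<le> t \<Longrightarrow> p (t *\<^sub>R x) = t * p x"
  obtains f where "linear f" "\<And>x. f x \<le> p x" "f y = p y"
proof -
  define \<A> where "\<A> = {G. subspace G \<and> (y, p y) \<in> G \<and> (\<forall>(x, a)\<in>G. a \<le> p x)}"
  have p0: "p 0 = 0" using scale[of 0 0] by simp
  have neg: "- p y \<le> p (- y)" using add[of y "- y"] p0 by simp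
  have "t * p y \<le> p (t *\<^sub>R y)" for t
  proof (cases "t \<ge> 0")
    case False
    then have "- t * - p y \<le> - t * p (- y)" using neg by (intro mult_left_mono) auto
    also have "\<dots> = p (t *\<^sub>R y)" using False scale[of "- t" "- y"] by simp
    finally show ?thesis by simp
  qed (simp add: scale)
  then have "span {(y, p y)} \<in> \<A>"
    unfolding \<A>_def by (auto simp: span_base) (auto simp: span_singleton)
  then have "\<A> \<noteq> {}" by blast
  moreover have "\<Union>\<C> \<in> \<A>" if \<C>: "\<C> \<noteq> {}" "subset.chain \<A> \<C>" for \<C>
  proof -
    have C: "\<And>G. G \<in> \<C> \<Longrightarrow> G \<in> \<A>" using \<C>(2) by (auto simp: subset.chain_def)
    obtain G where "G \<in> \<C>" using \<C>(1) by blast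
    have "u + v \<in> \<Union>\<C>" if uv: "u \<in> \<Union>\<C>" "v \<in> \<Union>\<C>" for u v
    proof -
      obtain G1 G2 where G: "G1 \<in> \<C>" "u \<in> G1" "G2 \<in> \<C>" "v \<in> G2" using uv by blast
      then have "G1 \<subseteq> G2 \<or> G2 \<subseteq> G1"
        using \<C>(2) by (auto simp: subset_chain_def)
      then obtain H where "H \<in> \<C>" "u \<in> H" "v \<in> H" using G by blast
      then show ?thesis using C[of H] by (auto simp: \<A>_def intro: subspace_add)
    qed
    moreover have "0 \<in> \<Union>\<C>" using \<open>G \<in> \<C>\<close> C[of G] by (auto simp: \<A>_def intro: subspace_0)
    moreover have "t *\<^sub>R u \<in> \<Union>\<C>" if "u \<in> \<Union>\<C>" for t u
      using that C by (auto simp: \<A>_def intro: subspace_scale)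
    ultimately have "subspace (\<Union>\<C>)" unfolding subspace_def by blast
    then show ?thesis using \<open>G \<in> \<C>\<close> C by (fastforce simp: \<A>_def)
  qed
  ultimately obtain G where G: "G \<in> \<A>" and max: "\<And>H. H \<in> \<A> \<Longrightarrow> G \<subseteq> H \<Longrightarrow> H = G"
    by (metis subset_Zorn_nonempty)
  have sub: "subspace G" and yG: "(y, p y) \<in> G" and dom: "\<And>x a. (x, a) \<in> G \<Longrightarrow> a \<le> p x"
    using G by (auto simp: \<A>_def)
  have total: "\<exists>a. (x, a) \<in> G" for x
  proof -
    obtain H where H: "G \<subseteq> H" "subspace H" "\<And>x a. (x, a) \<in> H \<Longrightarrow> a \<le> p x" "x \<in> fst ` H"
      using sublinear_graph_extend[of p G x, OF add scale sub dom] by blast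
    have "H = G" using H yG by (intro max) (auto simp: \<A>_def)
    then show ?thesis using H(4) by force
  qed
  \<comment> \<open>Both differences of the two values lie over \<open>0\<close>, hence are at most
    \<open>p 0 = 0\<close>.\<close>
  have unique: "a = b" if "(x, a) \<in> G" "(x, b) \<in> G" for x a b
  proof -
    have "(0, a - b) \<in> G" "(0, b - a) \<in> G"
      using subspace_diff[OF sub that] subspace_diff[OF sub that(2,1)] by auto
    from this[THEN dom] show ?thesis using p0 by simp
  qed
  obtain f where f: "\<And>x. (x, f x) \<in> G" using total by metis
  show thesis
  proof
    show "linear f"
    proof
      show "f (x + z) = f x + f z" for x z
        using subspace_add[OF sub f f, of x z] unique f by auto
      show "f (t *\<^sub>R x) = t *\<^sub>R f x" for t x
        using subspace_scale[OF sub f, of t x] unique f by auto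
    qed
    show "f x \<le> p x" for x using f dom by blast
    show "f y = p y" using f unique yG by blast
  qed
qed

lemma infdist_less_iff:
  assumes "S \<noteq> {}"
  shows "infdist x S < e \<longleftrightarrow> (\<exists>a\<in>S. dist x a < e)"
  using assms by (simp add: infdist_notempty cINF_less_iff)

text \<open>Near-optimal approximants of \<open>x\<close> and \<open>y\<close> add up to an
  approximant of \<open>x + y\<close>. Together with homogeneity this makes the distance to a
  subspace a sublinear functional.\<close>

lemma infdist_subspace_add:
  fixes S :: "'a::real_normed_vector set"
  assumes "subspace S"
  shows "infdist (x + y) S \<le> infdist x S + infdist y S"
proof (rule field_le_epsilon)
  fix e :: real assume "e > 0"
  have ne: "S \<noteq> {}" using subspace_0[OF assms] by blast
  obtain a b where "a \<in> S" "dist x a < infdist x S + e/2" "b \<in> S" "dist y b < infdist y S + e/2"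
    using \<open>e > 0\<close> infdist_less_iff[OF ne, of x "infdist x S + e/2"]
      infdist_less_iff[OF ne, of y "infdist y S + e/2"] by auto
  moreover have "infdist (x + y) S \<le> dist (x + y) (a + b)"
    using calculation assms by (intro infdist_le subspace_add)
  moreover have "dist (x + y) (a + b) \<le> dist x a + dist y b"
    by (rule dist_triangle_add)
  ultimately show "infdist (x + y) S \<le> infdist x S + infdist y S + e" by linarith
qed

lemma infdist_subspace_scale_le:
  fixes S :: "'a::real_normed_vector set"
  assumes "subspace S" "t > 0"
  shows "infdist (t *\<^sub>R x) S \<le> t * infdist x S"
proof (rule field_le_epsilon)
  fix e :: real assume "e > 0"
  have ne: "S \<noteq> {}" using subspace_0[OF assms(1)] by blast
  obtain a where a: "a \<in> S" "dist x a < infdist x S + e/t"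
    using \<open>e > 0\<close> \<open>t > 0\<close> infdist_less_iff[OF ne, of x "infdist x S + e/t"] by auto
  have "infdist (t *\<^sub>R x) S \<le> dist (t *\<^sub>R x) (t *\<^sub>R a)"
    using a assms by (intro infdist_le subspace_scale)
  also have "\<dots> = t * dist x a"
    using assms by (simp add: dist_norm flip: scaleR_diff_right)
  also have "\<dots> \<le> t * (infdist x S + e/t)"
    using a assms by (intro mult_left_mono) auto
  finally show "infdist (t *\<^sub>R x) S \<le> t * infdist x S + e"
    using assms by (simp add: algebra_simps)
qed

text \<open>A linear functional dominated by the distance to \<open>S\<close> is at most 0 at both
  \<open>x\<close> and \<open>- x\<close> for \<open>x\<close> in \<open>S\<close>, so it vanishes
  there; it is bounded because the distance is at most the norm. The one that equals the distance at
  \<open>y\<close> is nonzero there since \<open>S\<close> is closed, and is rescaled.\<close>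

lemma closed_subspace_separation:
  fixes S :: "'a::real_normed_vector set"
  assumes S: "subspace S" "closed S" and y: "y \<notin> S"
  obtains f :: "'a \<Rightarrow>\<^sub>L real" where "\<And>x. x \<in> S \<Longrightarrow> f x = 0" "f y = 1"
proof -
  let ?p = "\<lambda>x. infdist x S"
  have S0: "0 \<in> S" using subspace_0[OF S(1)] .
  have scale: "?p (t *\<^sub>R x) = t * ?p x" if "0 \<le> t" for t x
  proof (cases "t = 0")
    case False
    then have t: "t > 0" using that by simp
    \<comment> \<open>The one-sided scaling bound for the factor \<open>1/t\<close> is the reverse
      inequality for \<open>t\<close>.\<close>
    have "?p x \<le> (1/t) * ?p (t *\<^sub>R x)"
      using infdist_subspace_scale_le[OF S(1), of "1/t" "t *\<^sub>R x"] t by simp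
    then show ?thesis
      using infdist_subspace_scale_le[OF S(1) t, of x] t by (simp add: field_simps)
  qed (use S0 in simp)
  obtain f where f: "linear f" "\<And>x. f x \<le> ?p x" "f y = ?p y"
    using sublinear_dominated_functional[of ?p y] infdist_subspace_add[OF S(1)] scale by metis
  have le: "f x \<le> norm x" for x
    using f(2)[of x] infdist_le[OF S0, of x] by simp
  have abs: "\<bar>f x\<bar> \<le> norm x" for x
    using le[of x] le[of "- x"] linear_neg[OF f(1), of x] by simp
  have bl: "bounded_linear f"
    using f(1) abs by (intro bounded_linear_intro[where K = 1]) (auto simp: linear_iff)
  have zero: "f x = 0" if "x \<in> S" for x
    using f(2)[of x] f(2)[of "- x"] that subspace_neg[OF S(1) that] linear_neg[OF f(1), of x]
    by simp
  have "?p y > 0"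
    using y S S0 by (metis emptyE in_closed_iff_infdist_zero infdist_nonneg order_le_less)
  then show thesis
    using that[of "Blinfun (\<lambda>x. f x / ?p y)"] zero f(3)
    by (simp add: bounded_linear_Blinfun_apply bl bounded_linear_compose[OF bounded_linear_divide])
qed


section \<open>Separability of a space with separable dual\<close>

text \<open>Rational combinations indexed by lists form a countable set by construction. Continuity
  of addition and of scalar multiplication carries its algebraic closure properties to the
  topological closure, where density turns rational scalars into real ones.\<close>

lemma subspace_range_list_combinations:
  fixes x :: "nat \<Rightarrow> 'a::real_normed_vector"
  defines "D \<equiv> range (\<lambda>l :: (rat \<times> nat) list. \<Sum>(q, n)\<leftarrow>l. of_rat q *\<^sub>R x n)"
  shows "subspace (closure D)"
proof -
  have add: "u + v \<in> D" if uv: "u \<in> D" "v \<in> D" for u v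
  proof -
    obtain k l where "u = (\<Sum>(q, n)\<leftarrow>k. of_rat q *\<^sub>R x n)" "v = (\<Sum>(q, n)\<leftarrow>l. of_rat q *\<^sub>R x n)"
      using uv unfolding D_def by blast
    then have "u + v = (\<Sum>(q, n)\<leftarrow>k @ l. of_rat q *\<^sub>R x n)" by simp
    then show ?thesis unfolding D_def by blast
  qed
  have scale: "r *\<^sub>R u \<in> D" if r: "r \<in> \<rat>" and u: "u \<in> D" for r u
  proof -
    obtain s where s: "r = of_rat s" using r by (auto simp: Rats_def)
    have "s' *\<^sub>R (\<Sum>(q, n)\<leftarrow>l. of_rat q *\<^sub>R x n) =
        (\<Sum>(q, n)\<leftarrow>map (\<lambda>(q, n). (s * q, n)) l. of_rat q *\<^sub>R x n)" if "s' = of_rat s" for l s'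
      using that by (induction l) (auto simp: of_rat_mult scaleR_add_right)
    then show ?thesis using u s unfolding D_def by blast
  qed
  have "0 \<in> D" unfolding D_def by (rule image_eqI[of _ _ "[]"]) auto
  moreover have "u + v \<in> closure D" if "u \<in> closure D" "v \<in> closure D" for u v
  proof -
    have "(\<lambda>p. fst p + snd p) ` closure (D \<times> D) \<subseteq> closure D"
      using closure_subset[of D] add
      by (intro image_closure_subset continuous_intros) auto
    then show ?thesis using that by (force simp: closure_Times)
  qed
  moreover have "r *\<^sub>R u \<in> closure D" if "u \<in> closure D" for r u
  proof -
    have "(\<lambda>p. fst p *\<^sub>R snd p) ` closure (\<rat> \<times> D) \<subseteq> closure D"
      using closure_subset[of D] scale
      by (intro image_closure_subset continuous_intros) auto
    then show ?thesis using that by (force simp: closure_Times Rats_closure_real)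
  qed
  ultimately show ?thesis
    using closure_subset[of D] by (auto simp: subspace_def)
qed

text \<open>If no vector worked, half the norm would already bound the functional. The factor 1/2
  leaves room because the norm need not be attained.\<close>

lemma blinfun_norm_half_attained:
  fixes f :: "'a::real_normed_vector \<Rightarrow>\<^sub>L real"
  obtains x where "norm x \<le> 1" "norm f / 2 \<le> \<bar>f x\<bar>"
proof (cases "norm f = 0")
  case False
  then have pos: "norm f > 0" by simp
  have "\<exists>x. norm f / 2 * norm x < norm (f x)"
  proof (rule ccontr)
    assume "\<not> ?thesis"
    then have "norm f \<le> norm f / 2"
      by (intro norm_blinfun_bound) (auto simp: not_less)
    then show False using pos by simp
  qed
  then obtain x where x: "norm f / 2 * norm x < norm (f x)" by blast
  then have "x \<noteq> 0" by auto
  then show thesis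
    using that[of "(1 / norm x) *\<^sub>R x"] x
    by (simp add: blinfun.scaleR_right field_simps)
qed (use that[of 0] in simp)

text \<open>Normalized vectors that almost attain the norms of a dense sequence of functionals span a
  dense subspace, since a functional vanishing on all of them is zero.\<close>

lemma separable_dual_imp_countable_dense:
  assumes "separable_dual TYPE('a::real_normed_vector)"
  obtains D :: "'a::real_normed_vector set" where "countable D" "closure D = UNIV"
proof -
  obtain C :: "('a \<Rightarrow>\<^sub>L real) set" where C: "countable C" "closure C = UNIV"
    using assms by (auto simp: separable_dual_def separable_space_def)
  define f where "f = from_nat_into C"
  have "C \<noteq> {}" using C(2) by auto
  then have f: "range f = C" using C(1) by (simp add: f_def)
  have "\<exists>x. norm x \<le> 1 \<and> norm (f n) / 2 \<le> \<bar>f n x\<bar>" for n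
    by (meson blinfun_norm_half_attained)
  then obtain x where x: "\<And>n. norm (x n) \<le> 1" "\<And>n. norm (f n) / 2 \<le> \<bar>f n (x n)\<bar>"
    by metis
  define D where "D = range (\<lambda>l :: (rat \<times> nat) list. \<Sum>(q, n)\<leftarrow>l. of_rat q *\<^sub>R x n)"
  have sub: "subspace (closure D)"
    unfolding D_def by (rule subspace_range_list_combinations)
  have xD: "x n \<in> D" for n
    unfolding D_def by (rule image_eqI[of _ _ "[(1, n)]"]) auto
  have "y \<in> closure D" for y
  proof (rule ccontr)
    assume "y \<notin> closure D"
    then obtain g :: "'a \<Rightarrow>\<^sub>L real" where g: "\<And>z. z \<in> closure D \<Longrightarrow> g z = 0" "g y = 1"
      using closed_subspace_separation[OF sub closed_closure] by blast
    then have "g \<noteq> 0" by auto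
    \<comment> \<open>With this precision, \<open>f n (x n)\<close> is smaller than
      \<open>norm g / 4\<close> because \<open>g\<close> vanishes at \<open>x n\<close>. Hence
      \<open>norm (f n) < norm g / 2\<close>, and \<open>f n\<close> is too far from
      \<open>g\<close>.\<close>
    then have "norm g / 4 > 0" by simp
    then have "\<exists>h\<in>C. dist h g < norm g / 4"
      using closure_approachable[of g C] C(2) by blast
    then obtain n where n: "norm (f n - g) < norm g / 4"
      using f by (auto simp: dist_norm)
    have "\<bar>f n (x n)\<bar> = \<bar>(f n - g) (x n)\<bar>"
      using g(1)[of "x n"] xD[of n] closure_subset[of D] by (auto simp: blinfun.diff_left)
    also have "\<dots> \<le> norm (f n - g)"
      using norm_blinfun[of "f n - g" "x n"] x(1)[of n]
        mult_left_mono[of "norm (x n)" 1 "norm (f n - g)"]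
      by simp
    finally have "norm (f n) / 2 < norm g / 4" using n x(2)[of n] by linarith
    moreover have "norm g \<le> norm (f n) + norm (f n - g)"
      by (metis norm_triangle_sub add.commute norm_minus_commute)
    ultimately show False using n norm_ge_zero[of g] by linarith
  qed
  then show thesis using that[of D] by (auto simp: D_def)
qed

section \<open>Dense subspaces meet closed subspaces of finite codimension densely\<close>

text \<open>Approximants from \<open>V\<close> are pushed into the kernel by subtracting multiples
  of a fixed \<open>u\<close> with \<open>f u \<noteq> 0\<close>; the coefficients tend to
  \<open>f z / f u = 0\<close>. If there is no such \<open>u\<close>, the approximants lie in the
  kernel already.\<close>

lemma dense_inter_kernel:
  fixes f :: "'a::real_normed_vector \<Rightarrow>\<^sub>L real"
  assumes V: "subspace V" and dense: "G \<subseteq> closure (V \<inter> G)" and G: "subspace G"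
  shows "{z \<in> G. f z = 0} \<subseteq> closure (V \<inter> {z \<in> G. f z = 0})"
proof (cases "\<exists>u\<in>V \<inter> G. f u \<noteq> 0")
  case True
  then obtain u where u: "u \<in> V" "u \<in> G" "f u \<noteq> 0" by blast
  show ?thesis
  proof
    fix z assume z: "z \<in> {z \<in> G. f z = 0}"
    then obtain v where v: "\<And>n. v n \<in> V \<inter> G" "v \<longlonglongrightarrow> z"
      using dense closure_sequential[of z "V \<inter> G"] by auto
    define w where "w n = v n - (f (v n) / f u) *\<^sub>R u" for n
    have "w \<longlonglongrightarrow> z - (f z / f u) *\<^sub>R u"
      unfolding w_def by (intro tendsto_intros v u)
    then have "w \<longlonglongrightarrow> z" using z by simp
    moreover have "w n \<in> V \<inter> {z \<in> G. f z = 0}" for n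
      unfolding w_def using v(1)[of n] u V G
      by (auto simp: blinfun.diff_right blinfun.scaleR_right intro!: subspace_diff subspace_scale)
    ultimately show "z \<in> closure (V \<inter> {z \<in> G. f z = 0})"
      unfolding closure_sequential by blast
  qed
next
  case False
  then have "V \<inter> {z \<in> G. f z = 0} = V \<inter> G" by blast
  then show ?thesis using dense by auto
qed

text \<open>Induction on the vectors that complement \<open>F\<close>: adding one of them to
  \<open>F\<close> gives a larger closed subspace \<open>G\<close>, in which \<open>F\<close> is the
  kernel of a continuous functional.\<close>

lemma dense_inter_finite_codim:
  fixes F :: "'a::real_normed_vector set"
  assumes "finite K" and "subspace F" "closed F" "span (F \<union> K) = UNIV"
    and V: "subspace V" "closure V = UNIV"
  shows "F \<subseteq> closure (V \<inter> F)"
  using assms(1-4)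
proof (induction K arbitrary: F)
  case empty
  then have "F = UNIV" using span_eq_iff[of F] by simp
  then show ?case using V by simp
next
  case (insert k K)
  show ?case
  proof (cases "k \<in> F")
    case True
    then have "F \<union> insert k K = F \<union> K" by blast
    then show ?thesis using insert by metis
  next
    case False
    then obtain f :: "'a \<Rightarrow>\<^sub>L real" where f: "\<And>x. x \<in> F \<Longrightarrow> f x = 0" "f k = 1"
      using closed_subspace_separation insert.prems by blast
    \<comment> \<open>The projection along \<open>k\<close>. Its preimage of \<open>F\<close> is the
      sum of \<open>F\<close> and the line through \<open>k\<close>, in a form that makes closedness
      a matter of continuity.\<close>
    define h where "h z = z - f z *\<^sub>R k" for z
    define G where "G = h -` F"
    have "linear h" unfolding h_def
      by (intro linearI) (auto simp: blinfun.add_right blinfun.scaleR_right algebra_simps)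
    then have sub: "subspace G"
      using insert.prems(1)
      by (auto simp: G_def subspace_def linear_0 linear_add linear_scale)
    have "closed G"
      unfolding G_def h_def by (intro closed_vimage insert.prems continuous_intros)
    moreover have "F \<union> insert k K \<subseteq> span (G \<union> K)"
      using f insert.prems(1) by (auto simp: G_def h_def subspace_0 intro!: span_base)
    then have "span (G \<union> K) = UNIV"
      using insert.prems(3) span_mono span_span by (metis top.extremum_uniqueI)
    ultimately have "G \<subseteq> closure (V \<inter> G)" using insert.IH sub by blast
    moreover have "F = {z \<in> G. f z = 0}"
      using f by (auto simp: G_def h_def)
    ultimately show ?thesis
      using dense_inter_kernel[OF V(1) _ sub] by simp
  qed
qed

subsection \<open>A maximal ergodic inequality\<close>

text \<open>The maximum of the Birkhoff sums of \<open>f\<close> of lengths 0 to \<open>N\<close>,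
  written recursively so that Garsia's identity is the defining equation.\<close>

primrec max_birkhoff_sum :: "('x \<Rightarrow> 'x) \<Rightarrow> ('x \<Rightarrow> real) \<Rightarrow> nat \<Rightarrow> 'x \<Rightarrow> real" where
  "max_birkhoff_sum T f 0 x = 0"
| "max_birkhoff_sum T f (Suc N) x = max 0 (f x + max_birkhoff_sum T f N (T x))"

lemma max_birkhoff_sum_nonneg: "0 \<le> max_birkhoff_sum T f N x"
  by (cases N) auto

lemma max_birkhoff_sum_le_Suc: "max_birkhoff_sum T f N x \<le> max_birkhoff_sum T f (Suc N) x"
proof (induction N arbitrary: x)
  case (Suc N)
  show ?case using Suc[of "T x"] unfolding max_birkhoff_sum.simps(2)[of T f _ x] by simp
qed simp

lemma birkhoff_sum_le_max: "(\<Sum>j<n. f ((T ^^ j) x)) \<le> max_birkhoff_sum T f n x"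
proof (induction n arbitrary: x)
  case (Suc n)
  have "(\<Sum>j<Suc n. f ((T ^^ j) x)) = f x + (\<Sum>j<n. f ((T ^^ j) (T x)))"
    unfolding sum.lessThan_Suc_shift by (simp add: funpow_swap1)
  then show ?case using Suc[of "T x"] by simp
qed simp

locale measure_preserving_system = prob_space M for M :: "'x measure" +
  fixes T :: "'x \<Rightarrow> 'x"
  assumes T [measurable]: "T \<in> measurable M M" and T_preserving: "distr M M T = M"
begin

lemma integrable_max_birkhoff_sum:
  assumes "integrable M f"
  shows "integrable M (max_birkhoff_sum T f N)"
proof (induction N)
  case (Suc N)
  have "integrable M (\<lambda>x. max_birkhoff_sum T f N (T x))"
    using Suc integrable_distr[OF T, of "max_birkhoff_sum T f N"] T_preserving by simp
  then show ?case using assms by simp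
qed simp

text \<open>Garsia's argument: where the maximal sum is positive, it exceeds the previous maximal sum at
  the image point by exactly \<open>f\<close>.\<close>

lemma maximal_ergodic:
  assumes f: "integrable M f"
  shows "0 \<le> (\<integral>x. indicator {x \<in> space M. 0 < max_birkhoff_sum T f N x} x * f x \<partial>M)"
proof (cases N)
  case (Suc k)
  let ?M = "\<lambda>n. max_birkhoff_sum T f n"
  let ?E = "{x \<in> space M. 0 < ?M N x}"
  note [measurable] = borel_measurable_integrable[OF f]
    borel_measurable_integrable[OF integrable_max_birkhoff_sum[OF f]]
  have int: "integrable M (?M n)" "integrable M (\<lambda>x. ?M n (T x))" for n
    using integrable_max_birkhoff_sum[OF f] integrable_distr[OF T, of "?M n"] T_preserving
    by simp_all
  have "(\<integral>x. ?M k (T x) \<partial>M) = (\<integral>x. ?M k x \<partial>distr M M T)"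
    by (rule integral_distr[symmetric]) measurable
  then have eq: "(\<integral>x. ?M k (T x) \<partial>M) = (\<integral>x. ?M k x \<partial>M)" by (simp add: T_preserving)
  have "(\<integral>x. ?M k x \<partial>M) \<le> (\<integral>x. ?M N x \<partial>M)"
    by (intro integral_mono int) (metis Suc max_birkhoff_sum_le_Suc)
  \<comment> \<open>Invariance of the measure removes \<open>T\<close> from the second term, and the
    maximal sums increase with their length.\<close>
  then have "0 \<le> (\<integral>x. ?M N x - ?M k (T x) \<partial>M)" using int eq by simp
  also have "\<dots> \<le> (\<integral>x. indicator ?E x * f x \<partial>M)"
  proof (rule integral_mono)
    show "integrable M (\<lambda>x. indicator ?E x * f x)"
      by (rule Bochner_Integration.integrable_bound[OF f]) (auto split: split_indicator)
    \<comment> \<open>On \<open>?E\<close> this is an equality; off \<open>?E\<close> the first term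
      is 0 and the subtracted one is nonnegative.\<close>
    show "?M N x - ?M k (T x) \<le> indicator ?E x * f x" if "x \<in> space M" for x
      using that max_birkhoff_sum_nonneg[of T f k "T x"]
      by (auto simp: Suc split: split_indicator)
  qed (use int in simp)
  finally show ?thesis .
qed simp

text \<open>A Birkhoff sum of \<open>g\<close> exceeds \<open>\<alpha> * n\<close> exactly when that
  of \<open>g - \<alpha>\<close> is positive. The maximal ergodic inequality for
  \<open>g - \<alpha>\<close> bounds each \<open>E N\<close> as in Markov's inequality, and the
  \<open>E N\<close> increase to a set containing the one in question.\<close>

lemma weak_maximal_inequality:
  assumes g: "integrable M g" and nonneg: "\<And>x. x \<in> space M \<Longrightarrow> 0 \<le> g x" and "\<alpha> > 0"
  shows "measure M {x \<in> space M. \<exists>n. \<alpha> * real n < (\<Sum>j<n. g ((T ^^ j) x))} \<le> (\<integral>x. g x \<partial>M) / \<alpha>"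
proof -
  let ?f = "\<lambda>x. g x - \<alpha>"
  define E where "E N = {x \<in> space M. 0 < max_birkhoff_sum T ?f N x}" for N
  have f: "integrable M ?f" using g by simp
  note [measurable] = borel_measurable_integrable[OF g]
    borel_measurable_integrable[OF integrable_max_birkhoff_sum[OF f]]
  have E [measurable]: "E N \<in> sets M" for N unfolding E_def by measurable
  have bound: "measure M (E N) \<le> (\<integral>x. g x \<partial>M) / \<alpha>" for N
  proof -
    have int: "integrable M (\<lambda>x. indicator (E N) x * g x)"
      by (rule Bochner_Integration.integrable_bound[OF g]) (auto split: split_indicator)
    have int1: "integrable M (\<lambda>x. \<alpha> * indicator (E N) x)"
      by (intro integrable_mult_right integrable_real_indicator) (auto simp: less_top[symmetric])
    have "0 \<le> (\<integral>x. indicator (E N) x * g x - \<alpha> * indicator (E N) x \<partial>M)"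
      using maximal_ergodic[OF f, of N] by (simp add: E_def algebra_simps)
    also have "\<dots> = (\<integral>x. indicator (E N) x * g x \<partial>M) - \<alpha> * measure M (E N)"
      by (subst Bochner_Integration.integral_diff[OF int int1]) simp
    finally have "\<alpha> * measure M (E N) \<le> (\<integral>x. indicator (E N) x * g x \<partial>M)" by simp
    also have "\<dots> \<le> (\<integral>x. g x \<partial>M)"
      using int g nonneg by (intro integral_mono) (auto split: split_indicator)
    finally show ?thesis using \<open>\<alpha> > 0\<close> by (simp add: field_simps)
  qed
  have "incseq E"
    unfolding E_def using max_birkhoff_sum_le_Suc
    by (intro incseq_SucI) (fastforce intro: less_le_trans)
  then have "(\<lambda>N. measure M (E N)) \<longlonglongrightarrow> measure M (\<Union>N. E N)"
    by (intro finite_Lim_measure_incseq) auto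
  then have "measure M (\<Union>N. E N) \<le> (\<integral>x. g x \<partial>M) / \<alpha>"
    using bound by (intro LIMSEQ_le_const2) auto
  moreover have "{x \<in> space M. \<exists>n. \<alpha> * real n < (\<Sum>j<n. g ((T ^^ j) x))} \<subseteq> (\<Union>N. E N)"
  proof
    fix x assume "x \<in> {x \<in> space M. \<exists>n. \<alpha> * real n < (\<Sum>j<n. g ((T ^^ j) x))}"
    then obtain n where x: "x \<in> space M" "\<alpha> * real n < (\<Sum>j<n. g ((T ^^ j) x))" by blast
    then have "0 < (\<Sum>j<n. ?f ((T ^^ j) x))" by (simp add: sum_subtractf algebra_simps)
    also have "\<dots> \<le> max_birkhoff_sum T ?f n x" by (rule birkhoff_sum_le_max)
    finally show "x \<in> (\<Union>N. E N)" using x by (auto simp: E_def)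
  qed
  then have "measure M {x \<in> space M. \<exists>n. \<alpha> * real n < (\<Sum>j<n. g ((T ^^ j) x))} \<le> measure M (\<Union>N. E N)"
    by (rule finite_measure_mono) auto
  ultimately show ?thesis by linarith
qed

text \<open>The functions \<open>g k\<close> tend to 0 pointwise under the dominating function
  \<open>h\<close>, so their integrals tend to 0. By the weak maximal inequality so do the measures
  of the exceptional sets \<open>E k\<close>, whose intersection is therefore null; the index
  \<open>k\<close> depends on \<open>x\<close>.\<close>

lemma AE_small_birkhoff_sums:
  assumes h: "integrable M h" and nonneg: "\<And>x. x \<in> space M \<Longrightarrow> 0 \<le> h x" and "\<alpha> > 0"
    and Z: "\<And>k. Z k \<in> sets M"
    and vanish: "\<And>x. x \<in> space M \<Longrightarrow> \<forall>\<^sub>F k in sequentially. x \<notin> Z k"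
  shows "AE x in M. \<exists>k. \<forall>n. (\<Sum>j<n. indicator (Z k) ((T ^^ j) x) * h ((T ^^ j) x)) \<le> \<alpha> * real n"
proof -
  define g where "g k x = indicator (Z k) x * h x" for k x
  define E where "E k = {x \<in> space M. \<exists>n. \<alpha> * real n < (\<Sum>j<n. g k ((T ^^ j) x))}" for k
  note [measurable] = borel_measurable_integrable[OF h] Z
  have gm [measurable]: "g k \<in> borel_measurable M" for k unfolding g_def by measurable
  have Tn [measurable]: "(T ^^ j) \<in> measurable M M" for j by (induction j) auto
  have E [measurable]: "E k \<in> sets M" for k unfolding E_def by measurable
  have int: "integrable M (g k)" for k
    by (rule Bochner_Integration.integrable_bound[OF h]) (auto simp: g_def split: split_indicator)
  have "(\<lambda>k. \<integral>x. g k x \<partial>M) \<longlonglongrightarrow> (\<integral>x. 0 \<partial>M)"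
  proof (rule integral_dominated_convergence[where w = h])
    show "AE x in M. (\<lambda>k. g k x) \<longlonglongrightarrow> 0"
    proof (rule AE_I2)
      fix x assume "x \<in> space M"
      from vanish[OF this] have "\<forall>\<^sub>F k in sequentially. g k x = 0"
        by eventually_elim (simp add: g_def)
      then show "(\<lambda>k. g k x) \<longlonglongrightarrow> 0" by (rule tendsto_eventually)
    qed
    show "AE x in M. norm (g k x) \<le> h x" for k
      using nonneg by (intro AE_I2) (auto simp: g_def split: split_indicator)
  qed (use h in auto)
  then have lim: "(\<lambda>k. (\<integral>x. g k x \<partial>M) / \<alpha>) \<longlonglongrightarrow> 0" using tendsto_divide_zero by fastforce
  have "measure M (\<Inter>k. E k) \<le> (\<integral>x. g k x \<partial>M) / \<alpha>" for k
  proof -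
    have "measure M (\<Inter>k. E k) \<le> measure M (E k)" by (rule finite_measure_mono) auto
    also have "\<dots> \<le> (\<integral>x. g k x \<partial>M) / \<alpha>"
      unfolding E_def using nonneg \<open>\<alpha> > 0\<close> 
      by (intro weak_maximal_inequality int) (auto simp: g_def split: split_indicator)
    finally show ?thesis .
  qed
  then have "measure M (\<Inter>k. E k) \<le> 0" using lim by (intro LIMSEQ_le_const) auto
  then have "measure M (\<Inter>k. E k) = 0" using measure_nonneg[of M "\<Inter>k. E k"] by linarith
  then have "(\<Inter>k. E k) \<in> null_sets M" by (auto simp: null_sets_def emeasure_eq_measure)
  then have "AE x in M. x \<notin> (\<Inter>k. E k)" by (rule AE_not_in)
  then show ?thesis
    using AE_space by eventually_elim (auto simp: E_def g_def not_less)
qed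

lemma funpow_in_space: "x \<in> space M \<Longrightarrow> (T ^^ n) x \<in> space M"
  using measurable_space[OF T] by (induction n) auto

end

subsection \<open>Comparison of growth rates\<close>

text \<open>An Ehrling-type inequality. If it failed for every \<open>k\<close>, there would be unit
  vectors \<open>u k\<close> with \<open>\<iota> (u k)\<close> tending to 0 while
  \<open>L (u k)\<close> has norm above \<open>\<epsilon>\<close>; compactness produces a limit of a
  subsequence, which must be 0. A constant that works can be enlarged, hence
  \<open>eventually\<close>.\<close>

lemma compact_operator_interpolation:
  fixes L :: "'v::real_normed_vector \<Rightarrow>\<^sub>L 'v" and N :: "'b::real_normed_vector \<Rightarrow>\<^sub>L 'b"
  assumes \<iota>: "bounded_linear \<iota>" "inj \<iota>" and L: "compact_operator L"
    and intertwine: "\<And>v. N (\<iota> v) = \<iota> (L v)" and "\<epsilon> > 0"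
  shows "\<forall>\<^sub>F k in sequentially. \<forall>v. norm (L v) \<le> \<epsilon> * norm v + real k * norm (\<iota> v)"
proof -
  interpret \<iota>: bounded_linear \<iota> by fact
  have "\<exists>k. \<forall>v. norm (L v) \<le> \<epsilon> * norm v + real k * norm (\<iota> v)"
  proof (rule ccontr)
    assume "\<not> ?thesis"
    then obtain v where v: "\<And>k. \<epsilon> * norm (v k) + real k * norm (\<iota> (v k)) < norm (L (v k))"
      by (metis not_less)
    have pos: "norm (v k) > 0" for k
      using v[of k] by (cases "v k = 0") (auto simp: \<iota>.zero)
    define u where "u k = (1 / norm (v k)) *\<^sub>R v k" for k
    have u1: "norm (u k) = 1" for k using pos[of k] by (simp add: u_def)
    have u2: "\<epsilon> + real k * norm (\<iota> (u k)) < norm (L (u k))" for k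
      using mult_strict_left_mono[OF v[of k], of "1 / norm (v k)"] pos[of k]
      by (simp add: u_def \<iota>.scaleR blinfun.scaleR_right distrib_left)
    have "\<forall>k. L (u k) \<in> closure (blinfun_apply L ` cball 0 1)"
      using u1 closure_subset[of "blinfun_apply L ` cball 0 1"] by auto
    then obtain w s where s: "strict_mono (s :: nat \<Rightarrow> nat)" "(\<lambda>k. L (u (s k))) \<longlonglongrightarrow> w"
      using seq_compactE[OF compact_imp_seq_compact[OF L[unfolded compact_operator_def]],
          where f = "\<lambda>k. L (u k)"] unfolding o_def by blast
    have "norm (\<iota> (u k)) \<le> norm L * inverse (real k)" if "k > 0" for k
    proof -
      have "real k * norm (\<iota> (u k)) \<le> norm (L (u k))" using u2[of k] \<open>\<epsilon> > 0\<close> by simp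
      also have "\<dots> \<le> norm L" using norm_blinfun[of L "u k"] u1[of k] by simp
      finally show ?thesis using that by (simp add: field_simps)
    qed
    then have "\<forall>\<^sub>F k in sequentially. norm (\<iota> (u k)) \<le> norm L * inverse (real k)"
      by (rule eventually_mono[OF eventually_gt_at_top[of 0]])
    moreover have "(\<lambda>k. norm L * inverse (real k)) \<longlonglongrightarrow> 0"
      by real_asymp
    ultimately have "(\<lambda>k. \<iota> (u k)) \<longlonglongrightarrow> 0"
      by (rule Lim_null_comparison)
    then have "(\<lambda>k. \<iota> (u (s k))) \<longlonglongrightarrow> 0"
      using LIMSEQ_subseq_LIMSEQ[OF _ s(1)] by (simp add: o_def)
    \<comment> \<open>The limit \<open>w\<close> is identified in the weaker norm, where
      \<open>N\<close> is continuous; injectivity of \<open>\<iota>\<close> then gives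
      \<open>w = 0\<close>.\<close>
    then have "(\<lambda>k. N (\<iota> (u (s k)))) \<longlonglongrightarrow> N 0"
      by (intro tendsto_intros)
    then have "(\<lambda>k. \<iota> (L (u (s k)))) \<longlonglongrightarrow> \<iota> 0"
      by (simp add: intertwine \<iota>.zero)
    moreover have "(\<lambda>k. \<iota> (L (u (s k)))) \<longlonglongrightarrow> \<iota> w"
      using s(2) by (rule \<iota>.tendsto)
    ultimately have "\<iota> w = \<iota> 0" using LIMSEQ_unique by blast
    then have "w = 0" by (rule injD[OF \<iota>(2)])
    then have "(\<lambda>k. norm (L (u (s k)))) \<longlonglongrightarrow> 0"
      using tendsto_norm_zero s(2) by blast
    moreover have "\<epsilon> \<le> norm (L (u (s k)))" for k
      using u2[of "s k"] by (smt (verit) mult_nonneg_nonneg norm_ge_zero of_nat_0_le_iff)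
    ultimately have "\<epsilon> \<le> 0" by (intro LIMSEQ_le_const) auto
    then show False using \<open>\<epsilon> > 0\<close> by simp
  qed
  then obtain k0 where k0: "\<And>v. norm (L v) \<le> \<epsilon> * norm v + real k0 * norm (\<iota> v)" by blast
  show ?thesis
  proof (rule eventually_mono[OF eventually_ge_at_top[of k0]], intro allI)
    fix k v assume "k0 \<le> k"
    then have "real k0 * norm (\<iota> v) \<le> real k * norm (\<iota> v)" by (intro mult_right_mono) auto
    then show "norm (L v) \<le> \<epsilon> * norm v + real k * norm (\<iota> v)" using k0[of v] by linarith
  qed
qed

text \<open>The bad times enter through \<open>g\<close>, which also pays for the missing factor \<open>\<epsilon>\<close>. Hence every step
  has the same contraction factor \<open>\<epsilon> \<le> exp \<mu>\<close>, and the contribution of each \<open>b k\<close> is of the order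
  \<open>exp (n * \<mu>)\<close>, also when \<open>\<mu>\<close> is negative.\<close>

lemma perturbed_recursion_bound:
  fixes a b g :: "nat \<Rightarrow> real"
  assumes step: "\<And>n. a (Suc n) \<le> \<epsilon> * exp (g n) * a n + K * b n"
    and a: "\<And>n. 0 \<le> a n" and g: "\<And>n. 0 \<le> g n" and b: "\<And>n. b n \<le> C * exp (real n * \<mu>)"
    and "0 \<le> K" "0 \<le> C" "\<epsilon> \<le> exp \<mu>"
  shows "a n \<le> exp ((\<Sum>j<n. g j) + real n * \<mu>) * (a 0 + real n * (K * C * exp (- \<mu>)))"
proof (induction n)
  case (Suc n)
  let ?D = "K * C * exp (- \<mu>)" and ?S = "\<lambda>n. \<Sum>j<n. g j"
  have S: "0 \<le> ?S (Suc n)" using g by (intro sum_nonneg)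
  have D: "0 \<le> ?D" using assms by simp
  have "\<epsilon> * exp (g n) * a n \<le> exp \<mu> * exp (g n) * a n"
    using assms by (intro mult_right_mono) auto
  also have "\<dots> \<le> exp \<mu> * exp (g n) * (exp (?S n + real n * \<mu>) * (a 0 + real n * ?D))"
    by (intro mult_left_mono Suc) auto
  also have "\<dots> = exp (?S (Suc n) + real (Suc n) * \<mu>) * (a 0 + real n * ?D)"
    by (simp add: exp_add algebra_simps)
  finally have 1: "\<epsilon> * exp (g n) * a n \<le> exp (?S (Suc n) + real (Suc n) * \<mu>) * (a 0 + real n * ?D)" .
  \<comment> \<open>The factor \<open>exp (- \<mu>)\<close> in \<open>?D\<close> compensates for the
    shift of the exponent from \<open>n\<close> to \<open>Suc n\<close>.\<close>
  have "K * b n \<le> K * (C * exp (real n * \<mu>))"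
    using assms by (intro mult_left_mono) auto
  also have "\<dots> = exp (real (Suc n) * \<mu>) * ?D"
    by (simp add: exp_add exp_minus algebra_simps)
  also have "\<dots> \<le> exp (?S (Suc n) + real (Suc n) * \<mu>) * ?D"
    using S D by (intro mult_right_mono) auto
  finally have "a (Suc n) \<le> exp (?S (Suc n) + real (Suc n) * \<mu>) * (a 0 + real n * ?D)
      + exp (?S (Suc n) + real (Suc n) * \<mu>) * ?D"
    using 1 step[of n] by linarith
  then show ?case by (simp add: algebra_simps)
qed simp

section \<open>Exponents and exponential bounds along an orbit\<close>

lemma growth_bound_of_lyap:
  assumes "convergent (growth_seq T A x v)" and "lyap T A x v < ereal \<mu>"
  obtains C where "0 \<le> C" "\<And>n. norm (cocycle T A n x v) \<le> C * exp (real n * \<mu>)"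
proof -
  let ?b = "\<lambda>n. norm (cocycle T A n x v)"
  have "growth_seq T A x v \<longlonglongrightarrow> lyap T A x v"
    using assms(1) by (simp add: lyap_def convergent_LIMSEQ_iff)
  then have "\<forall>\<^sub>F n in sequentially. growth_seq T A x v n < ereal \<mu>"
    using assms(2) by (rule order_tendstoD)
  then have "\<forall>\<^sub>F n in sequentially. ?b n \<le> exp (real n * \<mu>)"
    \<comment> \<open>At index 0 the factor \<open>1 / real 0\<close> is 0, so
      \<open>growth_seq\<close> carries no information there.\<close>
    using eventually_gt_at_top[of 0]
  proof eventually_elim
    case (elim n)
    show ?case
    proof (cases "?b n = 0")
      case False
      then have "ln (?b n) < real n * \<mu>"
        using elim by (simp add: growth_seq_def elog_def field_simps)
      then show ?thesis using False
        by (metis exp_le_cancel_iff exp_ln less_imp_le norm_ge_zero order_le_less)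
    qed simp
  qed
  then obtain n0 where n0: "\<And>n. n \<ge> n0 \<Longrightarrow> ?b n \<le> exp (real n * \<mu>)"
    by (auto simp: eventually_sequentially)
  \<comment> \<open>The summand 1 serves all \<open>n \<ge> n0\<close>, the sum the finitely many
    earlier times.\<close>
  define C where "C = 1 + (\<Sum>n<n0. ?b n * exp (- (real n * \<mu>)))"
  have C1: "1 \<le> C" unfolding C_def by (simp add: sum_nonneg)
  show thesis
  proof
    show "0 \<le> C" using C1 by simp
    show "?b n \<le> C * exp (real n * \<mu>)" for n
    proof (cases "n < n0")
      case True
      have "?b n * exp (- (real n * \<mu>)) \<le> (\<Sum>n<n0. ?b n * exp (- (real n * \<mu>)))"
        using True by (intro member_le_sum) auto
      then have "?b n * exp (- (real n * \<mu>)) \<le> C" by (simp add: C_def)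
      then show ?thesis by (simp add: exp_minus field_simps)
    next
      case False
      have "1 * exp (real n * \<mu>) \<le> C * exp (real n * \<mu>)" using C1 by (intro mult_right_mono) auto
      then show ?thesis using n0[of n] False by (intro order_trans[OF n0]) auto
    qed
  qed
qed

text \<open>A factor of linear growth contributes nothing to the exponential rate.\<close>

lemma lyap_le_of_growth_bound:
  assumes conv: "convergent (growth_seq T A x v)" and "0 \<le> c" "0 \<le> d"
    and bound: "\<And>n. norm (cocycle T A n x v) \<le> exp (real n * \<mu>) * (c + real n * d)"
  shows "lyap T A x v \<le> ereal \<mu>"
proof -
  have lim: "growth_seq T A x v \<longlonglongrightarrow> lyap T A x v"
    using conv by (simp add: lyap_def convergent_LIMSEQ_iff)
  \<comment> \<open>The added 1 keeps the argument of the logarithm positive when \<open>c\<close>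
    and \<open>d\<close> both vanish.\<close>
  have "(\<lambda>n. \<mu> + ln (1 + c + real n * d) / real n) \<longlonglongrightarrow> \<mu>"
  proof (cases "d = 0")
    case True
    then show ?thesis using tendsto_add[OF tendsto_const lim_const_over_n] by fastforce
  next
    case False
    then have "d > 0" using \<open>0 \<le> d\<close> by simp
    then show ?thesis by real_asymp
  qed
  then have lim2: "(\<lambda>n. ereal (\<mu> + ln (1 + c + real n * d) / real n)) \<longlonglongrightarrow> ereal \<mu>"
    by simp
  have "\<forall>\<^sub>F n in sequentially. growth_seq T A x v n \<le> ereal (\<mu> + ln (1 + c + real n * d) / real n)"
    using eventually_gt_at_top[of 0]
  proof eventually_elim
    case (elim n)
    let ?b = "norm (cocycle T A n x v)"
    show ?case
    proof (cases "?b = 0")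
      case False
      then have "?b > 0" by simp
      moreover have nd: "0 \<le> real n * d" using assms by simp
      then have "exp (real n * \<mu>) * (c + real n * d) \<le> exp (real n * \<mu>) * (1 + c + real n * d)"
        by (intro mult_left_mono) auto
      then have "?b \<le> exp (real n * \<mu>) * (1 + c + real n * d)" using bound[of n] by linarith
      ultimately have "ln ?b \<le> ln (exp (real n * \<mu>) * (1 + c + real n * d))"
        by (intro ln_mono) auto
      also have "\<dots> = real n * \<mu> + ln (1 + c + real n * d)"
        using nd assms(2) by (subst ln_mult_pos) (auto intro: add_pos_nonneg)
      finally show ?thesis using False elim by (simp add: growth_seq_def elog_def field_simps)
    qed (use elim in \<open>simp add: growth_seq_def elog_def\<close>)
  qed
  then show ?thesis by (rule tendsto_le[OF _ lim2 lim, rotated]) simp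
qed

lemma cocycle_intertwine:
  fixes \<iota> :: "'v::real_normed_vector \<Rightarrow> 'b::real_normed_vector"
    and A :: "'x \<Rightarrow> 'b \<Rightarrow>\<^sub>L 'b" and A\<^sub>V :: "'x \<Rightarrow> 'v \<Rightarrow>\<^sub>L 'v"
  assumes "\<And>n v. A ((T ^^ n) x) (\<iota> v) = \<iota> (A\<^sub>V ((T ^^ n) x) v)"
  shows "cocycle T A n x (\<iota> v) = \<iota> (cocycle T A\<^sub>V n x v)"
  using assms by (induction n) auto

lemma growth_seq_mono:
  assumes "norm (cocycle T A n x v) \<le> norm (cocycle T A' n x w)"
  shows "growth_seq T A x v n \<le> growth_seq T A' x w n"
  unfolding growth_seq_def
  by (rule ereal_mult_left_mono) (use assms in \<open>auto simp: elog_def\<close>)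


lemma lyap_mono:
  assumes "\<And>n. norm (cocycle T A n x v) \<le> norm (cocycle T A' n x w)"
    and "convergent (growth_seq T A x v)" "convergent (growth_seq T A' x w)"
  shows "lyap T A x v \<le> lyap T A' x w"
proof (rule LIMSEQ_le)
  show "growth_seq T A x v \<longlonglongrightarrow> lyap T A x v" "growth_seq T A' x w \<longlonglongrightarrow> lyap T A' x w"
    using assms(2,3) by (simp_all add: lyap_def convergent_LIMSEQ_iff)
  show "\<exists>N. \<forall>n\<ge>N. growth_seq T A x v n \<le> growth_seq T A' x w n"
    using growth_seq_mono[OF assms(1)] by blast
qed

lemma norm_le_exp_log_plus: "0 \<le> t \<Longrightarrow> t \<le> exp (log_plus t)"
  by (cases "t = 0") (auto simp: log_plus_def max_def not_le ln_le_zero_iff)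

text \<open>The norms along an orbit in the smaller space satisfy a recursion driven by the norms of
  the same orbit in the larger one. \<open>Z\<close> is the set of bad points, and \<open>l\<close>
  is large enough for \<open>exp (- l)\<close> to be at most \<open>exp \<mu>\<close>.\<close>

lemma lyap_le_of_interpolation:
  fixes \<iota> :: "'v::real_normed_vector \<Rightarrow> 'b::real_normed_vector"
    and A :: "'x \<Rightarrow> 'b \<Rightarrow>\<^sub>L 'b" and A\<^sub>V :: "'x \<Rightarrow> 'v \<Rightarrow>\<^sub>L 'v"
  assumes intertwine: "\<And>n v. A ((T ^^ n) x) (\<iota> v) = \<iota> (A\<^sub>V ((T ^^ n) x) v)"
    and good: "\<And>n v. (T ^^ n) x \<notin> Z \<Longrightarrow>
      norm (A\<^sub>V ((T ^^ n) x) v) \<le> exp (- real l) * norm v + real k * norm (\<iota> v)"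
    and rare: "\<And>n. (\<Sum>j<n. indicator Z ((T ^^ j) x) *
      (log_plus (norm (A\<^sub>V ((T ^^ j) x))) + real l)) \<le> \<alpha> * real n"
    and conv: "convergent (growth_seq T A x (\<iota> v))" "convergent (growth_seq T A\<^sub>V x v)"
    and \<mu>: "lyap T A x (\<iota> v) < ereal \<mu>" "- \<mu> \<le> real l"
  shows "lyap T A\<^sub>V x v \<le> ereal (\<mu> + \<alpha>)"
proof -
  define a where "a n = norm (cocycle T A\<^sub>V n x v)" for n
  define b where "b n = norm (cocycle T A n x (\<iota> v))" for n
  \<comment> \<open>At bad times the added \<open>l\<close> cancels \<open>exp (- l)\<close> and
    leaves the operator norm bound; at good times \<open>h\<close> is 0. The recursion thus has one
    form at all times.\<close>
  define h where "h n = indicator Z ((T ^^ n) x) *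
      (log_plus (norm (A\<^sub>V ((T ^^ n) x))) + real l)" for n
  obtain C where C: "0 \<le> C" "\<And>n. b n \<le> C * exp (real n * \<mu>)"
    using growth_bound_of_lyap[OF conv(1) \<mu>(1)] unfolding b_def by blast
  let ?D = "real k * C * exp (- \<mu>)"
  have h: "0 \<le> h n" for n by (simp add: h_def log_plus_def)
  have "a (Suc n) \<le> exp (- real l) * exp (h n) * a n + real k * b n" for n
  proof (cases "(T ^^ n) x \<in> Z")
    case True
    let ?L = "A\<^sub>V ((T ^^ n) x)"
    have "a (Suc n) \<le> norm ?L * a n"
      unfolding a_def by (simp add: norm_blinfun)
    also have "\<dots> \<le> exp (log_plus (norm ?L)) * a n"
      unfolding a_def by (intro mult_right_mono norm_le_exp_log_plus) auto
    also have "\<dots> = exp (- real l) * exp (h n) * a n"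
      using True by (simp add: h_def exp_add exp_minus)
    finally show ?thesis by (smt (verit) b_def mult_nonneg_nonneg norm_ge_zero of_nat_0_le_iff)
  next
    case False
    then have "h n = 0" by (simp add: h_def)
    then show ?thesis
      using good[OF False, of "cocycle T A\<^sub>V n x v"]
        cocycle_intertwine[where A = A and \<iota> = \<iota> and A\<^sub>V = A\<^sub>V, OF intertwine]
      by (simp add: a_def b_def)
  qed
  then have bound: "a n \<le> exp ((\<Sum>j<n. h j) + real n * \<mu>) * (a 0 + real n * ?D)" for n
    using h C \<mu>(2)
    by (intro perturbed_recursion_bound[where b = b and \<epsilon> = "exp (- real l)"]) (auto simp: a_def)
  have "exp ((\<Sum>j<n. h j) + real n * \<mu>) * (a 0 + real n * ?D) \<le>
      exp (real n * (\<mu> + \<alpha>)) * (a 0 + real n * ?D)" for n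
    using rare[of n] C by (intro mult_right_mono) (auto simp: h_def a_def algebra_simps)
  then have "a n \<le> exp (real n * (\<mu> + \<alpha>)) * (a 0 + real n * ?D)" for n
    using bound[of n] order_trans by blast
  then show ?thesis
    using C conv(2) unfolding a_def
    by (intro lyap_le_of_growth_bound[where c = "norm (cocycle T A\<^sub>V 0 x v)" and d = ?D]) auto
qed

text \<open>The exceptional null set is fixed before \<open>v\<close>: it is collected over the
  countably many pairs of contraction parameter \<open>l\<close> and tolerance
  \<open>inverse (Suc m)\<close>.\<close>

lemma (in measure_preserving_system) AE_lyap_restriction:
  fixes \<iota> :: "'v::real_normed_vector \<Rightarrow> 'b::real_normed_vector"
    and A :: "'x \<Rightarrow> 'b \<Rightarrow>\<^sub>L 'b" and A\<^sub>V :: "'x \<Rightarrow> 'v \<Rightarrow>\<^sub>L 'v"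
  assumes \<iota>: "linear \<iota>" "inj \<iota>" "\<And>v. norm (\<iota> v) \<le> norm v"
    and sep: "separable_dual TYPE('v)"
    and intertwine: "\<And>x v. x \<in> space M \<Longrightarrow> A x (\<iota> v) = \<iota> (A\<^sub>V x v)"
    and compact: "\<And>x. x \<in> space M \<Longrightarrow> compact_operator (A\<^sub>V x)"
    and meas: "strongly_measurable M A\<^sub>V"
    and int: "integrable M (\<lambda>x. log_plus (norm (A\<^sub>V x)))"
    and conv: "AE x in M. \<forall>v. convergent (growth_seq T A x v)"
      "AE x in M. \<forall>v. convergent (growth_seq T A\<^sub>V x v)"
  shows "AE x in M. \<forall>v. lyap T A\<^sub>V x v = lyap T A x (\<iota> v)"
proof -
  have bl: "bounded_linear \<iota>"
    using \<iota> by (intro bounded_linear_intro[where K = 1]) (auto simp: linear_iff)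
  obtain D :: "'v set" where D: "countable D" "closure D = UNIV"
    using separable_dual_imp_countable_dense[OF sep] .
  \<comment> \<open>The points where the interpolation inequality with
    \<open>\<epsilon> = exp (- l)\<close> and constant \<open>k\<close> fails. Testing it only on
    the countable dense set \<open>D\<close> makes \<open>Z l k\<close> measurable; continuity
    extends it to all vectors in \<open>good\<close>.\<close>
  define Z where "Z l k = (\<Union>v\<in>D. {x \<in> space M.
    exp (- real l) * norm v + real k * norm (\<iota> v) < norm (A\<^sub>V x v)})" for l k :: nat
  have [measurable]: "(\<lambda>x. A\<^sub>V x v) \<in> borel_measurable M" for v
    using meas by (simp add: strongly_measurable_def)
  have Z: "Z l k \<in> sets M" for l k
    unfolding Z_def by (intro sets.countable_UN'' D) measurable
  have good: "norm (A\<^sub>V x v) \<le> exp (- real l) * norm v + real k * norm (\<iota> v)"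
    if x: "x \<in> space M" "x \<notin> Z l k" for x l k v
  proof -
    let ?G = "{v. norm (A\<^sub>V x v) \<le> exp (- real l) * norm v + real k * norm (\<iota> v)}"
    have "closed ?G"
      by (intro closed_Collect_le continuous_intros linear_continuous_on bl)
    moreover have "D \<subseteq> ?G" using x by (auto simp: Z_def not_less)
    ultimately have "closure D \<subseteq> ?G" by (rule closure_minimal[rotated])
    then show ?thesis using D by blast
  qed
  have vanish: "\<forall>\<^sub>F k in sequentially. x \<notin> Z l k" if x: "x \<in> space M" for x l
  proof -
    have "\<forall>\<^sub>F k in sequentially. \<forall>v. norm (A\<^sub>V x v) \<le> exp (- real l) * norm v + real k * norm (\<iota> v)"
      by (rule compact_operator_interpolation[OF bl \<iota>(2) compact[OF x] intertwine[OF x]]) simp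
    then show ?thesis by eventually_elim (auto simp: Z_def not_less)
  qed
  have "AE x in M. \<exists>k. \<forall>n. (\<Sum>j<n. indicator (Z l k) ((T ^^ j) x) *
      (log_plus (norm (A\<^sub>V ((T ^^ j) x))) + real l)) \<le> inverse (real (Suc m)) * real n" for l m
    using AE_small_birkhoff_sums[of "\<lambda>x. log_plus (norm (A\<^sub>V x)) + real l"
        "inverse (real (Suc m))" "Z l"]
      int Z vanish by (simp add: log_plus_def)
  then have "AE x in M. \<forall>l m. \<exists>k. \<forall>n. (\<Sum>j<n. indicator (Z l k) ((T ^^ j) x) *
      (log_plus (norm (A\<^sub>V ((T ^^ j) x))) + real l)) \<le> inverse (real (Suc m)) * real n"
    by (simp only: AE_all_countable simp_thms)
  then show ?thesis
    using conv AE_space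
  proof eventually_elim
    case (elim x)
    have orbit: "(T ^^ n) x \<in> space M" for n by (intro funpow_in_space elim)
    show ?case
    proof
      fix v
      have "norm (cocycle T A n x (\<iota> v)) \<le> norm (cocycle T A\<^sub>V n x v)" for n
        by (subst cocycle_intertwine[where \<iota> = \<iota> and A\<^sub>V = A\<^sub>V]) (use orbit intertwine \<iota>(3) in auto)
      then have ge: "lyap T A x (\<iota> v) \<le> lyap T A\<^sub>V x v"
        using elim by (intro lyap_mono) auto
      \<comment> \<open>Any real \<open>\<mu>\<close> above the exponent is allowed, arbitrarily
        negative ones included if the exponent is -\<infinity>; this is why \<open>l\<close> has to
        vary. The tolerance then goes to 0.\<close>
      have "lyap T A\<^sub>V x v \<le> ereal \<mu>" if \<mu>: "lyap T A x (\<iota> v) < ereal \<mu>" for \<mu>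
      proof -
        obtain l :: nat where l: "- \<mu> \<le> real l" using real_arch_simple by blast
        have "lyap T A\<^sub>V x v \<le> ereal (\<mu> + inverse (real (Suc m)))" for m
        proof -
          obtain k where "\<And>n. (\<Sum>j<n. indicator (Z l k) ((T ^^ j) x) *
              (log_plus (norm (A\<^sub>V ((T ^^ j) x))) + real l)) \<le> inverse (real (Suc m)) * real n"
            using elim by blast
          then show ?thesis
            using elim orbit good intertwine \<mu> l
            by (intro lyap_le_of_interpolation
                [where Z = "Z l k" and l = l and k = k and A = A and \<iota> = \<iota>]) auto
        qed
        moreover have "(\<lambda>m. ereal (\<mu> + inverse (real (Suc m)))) \<longlonglongrightarrow> ereal \<mu>"
          by (intro tendsto_ereal LIMSEQ_inverse_real_of_nat_add)
        ultimately show ?thesis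
          using LIMSEQ_le_const[of "\<lambda>m. ereal (\<mu> + inverse (real (Suc m)))"] by blast
      qed
      then have "lyap T A\<^sub>V x v \<le> \<mu>" if "lyap T A x (\<iota> v) < \<mu>" for \<mu>
        using that by (cases \<mu>) auto
      then have "lyap T A\<^sub>V x v \<le> lyap T A x (\<iota> v)" by (rule dense_ge)
      then show "lyap T A\<^sub>V x v = lyap T A x (\<iota> v)" using ge by (rule antisym)
    qed
  qed
qed

subsection \<open>Lyapunov exponents and the filtration\<close>

text \<open>The number of values that are at least \<open>c\<close> strictly decreases as
  \<open>c\<close> increases through the values, so the rank determines the value and the definite
  description is well defined.\<close>

lemma lyap_exp_eqI:
  assumes fin: "\<forall>c. finite {d \<in> lyap_values T A x. c < d}"
    and c: "c \<in> lyap_values T A x" "card {d \<in> lyap_values T A x. c \<le> d} = i"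
  shows "lyap_exp T A i x = c"
proof -
  let ?V = "lyap_values T A x"
  have finite: "finite {d \<in> ?V. c \<le> d}" for c
    by (rule finite_subset[OF _ fin[rule_format, of "c - 1"]]) auto
  have less: "card {d \<in> ?V. c' \<le> d} < card {d \<in> ?V. c \<le> d}" if "c \<in> ?V" "c < c'" for c c'
  proof (rule psubset_card_mono[OF finite])
    have "c \<in> {d \<in> ?V. c \<le> d} - {d \<in> ?V. c' \<le> d}" using that by simp
    moreover have "{d \<in> ?V. c' \<le> d} \<subseteq> {d \<in> ?V. c \<le> d}" using that by auto
    ultimately show "{d \<in> ?V. c' \<le> d} \<subset> {d \<in> ?V. c \<le> d}" by blast
  qed
  show ?thesis
    unfolding lyap_exp_def
  proof (rule the_equality)
    show "c' = c" if "c' \<in> ?V \<and> card {d \<in> ?V. c' \<le> d} = i" for c'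
      using that c less[of c c'] less[of c' c] by (cases c c' rule: linorder_cases) auto
  qed (use c in simp)
qed

text \<open>Translates ranks into sublevel sets, with \<open>i\<close> the rank of \<open>c\<close>.
  The next member of the filtration is the strict sublevel set because no exponent lies strictly
  between \<open>c\<close> and the next lower value, or -\<infinity> if \<open>c\<close> is the
  least.\<close>

lemma lyap_filt_at_value:
  assumes fin: "\<forall>c. finite {d \<in> lyap_values T A x. c < d}"
    and bounded: "\<forall>v. lyap T A x v < \<infinity>"
    and c: "c \<in> lyap_values T A x"
  obtains i where "1 \<le> i" "enat i \<le> num_lyap T A x"
    "lyap_filt T A i x = {v. lyap T A x v \<le> ereal c}"
    "lyap_filt T A (Suc i) x = {v. lyap T A x v < ereal c}"
proof -
  let ?V = "lyap_values T A x"
  define i where "i = card {d \<in> ?V. c \<le> d}"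
  have finite: "finite {d \<in> ?V. c \<le> d}" for c
    by (rule finite_subset[OF _ fin[rule_format, of "c - 1"]]) auto
  have num: "enat (card W) \<le> num_lyap T A x" if "W \<subseteq> ?V" for W
    using that by (auto simp: num_lyap_def intro: card_mono)
  have value_cases: "lyap T A x v = - \<infinity> \<or> (\<exists>d\<in>?V. lyap T A x v = ereal d)" for v
    using bounded[rule_format, of v] by (cases "lyap T A x v")
      (auto simp: lyap_values_def intro: exI[of _ v])
  have i: "lyap_exp T A i x = c" "enat i \<le> num_lyap T A x"
    using lyap_exp_eqI[OF fin c] num unfolding i_def by auto
  have "lyap_filt T A (Suc i) x = {v. lyap T A x v < ereal c}"
  proof (cases "\<exists>d\<in>?V. d < c")
    case True
    then obtain d0 where d0: "d0 \<in> ?V" "d0 < c" by blast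
    \<comment> \<open>Only finitely many values lie between \<open>d0\<close> and \<open>c\<close>,
      so there is a largest value below \<open>c\<close>.\<close>
    let ?P = "{d \<in> ?V. d0 \<le> d \<and> d < c}"
    define c' where "c' = Max ?P"
    have P: "finite ?P" "d0 \<in> ?P" using finite[of d0] d0 by (auto elim: rev_finite_subset)
    then have c': "c' \<in> ?P" unfolding c'_def by (intro Max_in) auto
    have max: "d \<le> c'" if "d \<in> ?V" "d < c" for d
    proof (cases "d0 \<le> d")
      case True
      then show ?thesis using that P(1) unfolding c'_def by (intro Max_ge) auto
    next
      case False
      then show ?thesis using c' by simp
    qed
    have "{d \<in> ?V. c' \<le> d} = insert c' {d \<in> ?V. c \<le> d}"
      using c' max by force
    then have card: "card {d \<in> ?V. c' \<le> d} = Suc i"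
      using finite[of c] c' by (simp add: i_def)
    then have "lyap_exp T A (Suc i) x = c'" "enat (Suc i) \<le> num_lyap T A x"
      using lyap_exp_eqI[OF fin, of c'] num[of "{d \<in> ?V. c' \<le> d}"] c' by auto
    moreover have "lyap T A x v \<le> ereal c' \<longleftrightarrow> lyap T A x v < ereal c" for v
      using value_cases[of v]
    proof (elim disjE bexE)
      fix d assume "d \<in> ?V" "lyap T A x v = ereal d"
      then show ?thesis using max[of d] c' by auto
    qed simp
    ultimately show ?thesis by (simp add: lyap_filt_def)
  next
    case False
    \<comment> \<open>Here \<open>c\<close> is the least value, so \<open>Suc i\<close> exceeds the
      number of values and \<open>lyap_filt\<close> falls into its second case.\<close>
    then have "?V = {d \<in> ?V. c \<le> d}" by force
    then have "num_lyap T A x = enat i" using finite[of c] by (simp add: num_lyap_def i_def)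
    then have "lyap_filt T A (Suc i) x = {v. lyap T A x v = - \<infinity>}" by (simp add: lyap_filt_def)
    also have "\<dots> = {v. lyap T A x v < ereal c}"
      using value_cases False by fastforce
    finally show ?thesis .
  qed
  moreover have "1 \<le> i"
    using c finite[of c] by (auto simp: i_def Suc_le_eq card_gt_0_iff)
  ultimately show thesis using i by (intro that[of i]) (auto simp: lyap_filt_def)
qed

text \<open>If \<open>range \<iota>\<close> met the sublevel set \<open>?F\<close> of a value
  \<open>c\<close> only inside the strict sublevel set \<open>?F'\<close>, density in
  \<open>?F\<close> and closedness of \<open>?F'\<close> would give
  \<open>?F \<subseteq> ?F'\<close>, although \<open>c\<close> is attained. Hence \<open>c\<close>
  is attained on the range.\<close>

lemma lyap_values_restriction:
  fixes \<iota> :: "'v::real_normed_vector \<Rightarrow> 'b::real_normed_vector"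
    and A :: "'x \<Rightarrow> 'b \<Rightarrow>\<^sub>L 'b" and A\<^sub>V :: "'x \<Rightarrow> 'v \<Rightarrow>\<^sub>L 'v"
  assumes fin: "\<forall>c. finite {d \<in> lyap_values T A x. c < d}"
    and bounded: "\<forall>v. lyap T A x v < \<infinity>"
    and filt: "\<forall>i\<ge>1. enat i \<le> eSuc (num_lyap T A x) \<longrightarrow>
        closed (lyap_filt T A i x) \<and> finite_codim (lyap_filt T A i x)"
    and \<iota>: "linear \<iota>" "closure (range \<iota>) = UNIV"
    and eq: "\<forall>v. lyap T A\<^sub>V x v = lyap T A x (\<iota> v)"
  shows "lyap_values T A\<^sub>V x = lyap_values T A x"
proof
  show "lyap_values T A\<^sub>V x \<subseteq> lyap_values T A x"
    using eq by (auto simp: lyap_values_def)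
  show "lyap_values T A x \<subseteq> lyap_values T A\<^sub>V x"
  proof
    fix c assume c: "c \<in> lyap_values T A x"
    obtain i where i: "1 \<le> i" "enat i \<le> num_lyap T A x"
      and F: "lyap_filt T A i x = {v. lyap T A x v \<le> ereal c}" (is "_ = ?F")
      and F': "lyap_filt T A (Suc i) x = {v. lyap T A x v < ereal c}" (is "_ = ?F'")
      using lyap_filt_at_value[OF fin bounded c] .
    have "enat i \<le> eSuc (num_lyap T A x)"
      using i(2) ile_eSuc order_trans by blast
    then have "closed ?F" "finite_codim ?F"
      using filt i(1) F by auto
    then obtain K where K: "finite K" "subspace ?F" "closed ?F" "span (?F \<union> K) = UNIV"
      by (auto simp: finite_codim_def)
    \<comment> \<open>If \<open>c\<close> is the least value, \<open>Suc i\<close> is one more than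
      the number of values; the bound with \<open>eSuc\<close> covers this case.\<close>
    have "enat (Suc i) \<le> eSuc (num_lyap T A x)"
      using i(2) by (simp flip: eSuc_enat)
    then have closed: "closed ?F'" using filt[rule_format, of "Suc i"] F' by simp
    have sub: "subspace (range \<iota>)"
      using linear_subspace_image[OF \<iota>(1) subspace_UNIV] .
    have dense: "?F \<subseteq> closure (range \<iota> \<inter> ?F)"
      by (rule dense_inter_finite_codim[OF K sub \<iota>(2)])
    obtain w where w: "lyap T A x w = ereal c" using c by (auto simp: lyap_values_def)
    have "\<not> range \<iota> \<inter> ?F \<subseteq> ?F'"
    proof
      assume "range \<iota> \<inter> ?F \<subseteq> ?F'"
      then have "?F \<subseteq> ?F'" using dense closure_minimal[OF _ closed] by blast
      moreover have "w \<in> ?F" using w by simp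
      ultimately have "w \<in> ?F'" by blast
      then show False using w by simp
    qed
    then obtain v where "lyap T A x (\<iota> v) \<le> ereal c" "\<not> lyap T A x (\<iota> v) < ereal c" by blast
    then have "lyap T A x (\<iota> v) = ereal c" by simp
    then show "c \<in> lyap_values T A\<^sub>V x" using eq by (auto simp: lyap_values_def)
  qed
qed

lemma met_conclusion_AE_convergent:
  assumes "met_conclusion M T A"
  shows "AE x in M. \<forall>v. convergent (growth_seq T A x v)"
  using assms unfolding met_conclusion_def by eventually_elim blast

theorem theorem1:
  fixes M :: "'x measure"
    and T :: "'x \<Rightarrow> 'x"
    and \<iota> :: "'v::banach \<Rightarrow> 'b::banach"
    and A :: "'x \<Rightarrow> 'b \<Rightarrow>\<^sub>L 'b"
    and A\<^sub>V :: "'x \<Rightarrow> 'v \<Rightarrow>\<^sub>L 'v"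
  assumes "linear \<iota>" and "inj \<iota>"
    and "closure (range \<iota>) = UNIV"
    and "\<And>v. norm (\<iota> v) \<le> norm v"
    and "separable_dual TYPE('b)" and "separable_dual TYPE('v)"
    and "prob_space M" and "T \<in> measurable M M" and "distr M M T = M"
    and "strongly_measurable M A"
    and "\<And>x. x \<in> space M \<Longrightarrow> compact_operator (A x)"
    and "\<And>x v. x \<in> space M \<Longrightarrow> A x (\<iota> v) = \<iota> (A\<^sub>V x v)"
    and "\<And>x. x \<in> space M \<Longrightarrow> compact_operator (A\<^sub>V x)"
    and "strongly_measurable M A\<^sub>V"
    and "integrable M (\<lambda>x. log_plus (norm (A x)))"
    and "integrable M (\<lambda>x. log_plus (norm (A\<^sub>V x)))"
    and "met_conclusion M T A" and "met_conclusion M T A\<^sub>V"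
  shows "(AE x in M. num_lyap T A\<^sub>V x = num_lyap T A x) \<and>
    (\<forall>i\<ge>1. AE x in M. enat i \<le> num_lyap T A x \<longrightarrow>
       lyap_exp T A\<^sub>V i x = lyap_exp T A i x \<and>
       \<iota> ` lyap_filt T A\<^sub>V i x = lyap_filt T A i x \<inter> range \<iota>)"
proof -
  interpret measure_preserving_system M T
    using assms(7-9)
    by (simp add: measure_preserving_system_def measure_preserving_system_axioms_def)
  have conv: "AE x in M. \<forall>v. convergent (growth_seq T A x v)"
      "AE x in M. \<forall>v. convergent (growth_seq T A\<^sub>V x v)"
    using assms(17,18) by (simp_all add: met_conclusion_AE_convergent)
  have "AE x in M. \<forall>v. lyap T A\<^sub>V x v = lyap T A x (\<iota> v)"
    by (rule AE_lyap_restriction) (use assms conv in auto)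
  then have *: "AE x in M. (\<forall>v. lyap T A\<^sub>V x v = lyap T A x (\<iota> v)) \<and>
      lyap_values T A\<^sub>V x = lyap_values T A x"
    using assms(17) unfolding met_conclusion_def
  proof eventually_elim
    case (elim x)
    have "lyap_values T A\<^sub>V x = lyap_values T A x"
      by (rule lyap_values_restriction[OF _ _ _ assms(1,3)]) (use elim in blast)+
    then show ?case using elim by blast
  qed
  then have "AE x in M. num_lyap T A\<^sub>V x = num_lyap T A x"
    by eventually_elim (simp add: num_lyap_def)
  moreover have "AE x in M. enat i \<le> num_lyap T A x \<longrightarrow>
       lyap_exp T A\<^sub>V i x = lyap_exp T A i x \<and>
       \<iota> ` lyap_filt T A\<^sub>V i x = lyap_filt T A i x \<inter> range \<iota>" for i
    using *
  proof eventually_elim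
    case (elim x)
    \<comment> \<open>Both quantities depend on the cocycle only through its set of values.\<close>
    then have "lyap_exp T A\<^sub>V i x = lyap_exp T A i x" "num_lyap T A\<^sub>V x = num_lyap T A x"
      by (simp_all add: lyap_exp_def num_lyap_def)
    then show ?case using elim by (auto simp: lyap_filt_def)
  qed
  ultimately show ?thesis by blast
qed

end
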